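(* Let $p$ be a prime, let $\chi$ be a non-principal Dirichlet character modulo $p$, and let $f$ be the completely multiplicative function with $f(p)=1$ and $f(q)=\chi(q)$ for every prime $q\neq p$. For $0\le l\le p-1$ let $N(n,l)$ be the number of digits equal to $l$ in the base $p$ expansion of $n$. Then for every positive integer $n$, $$\sum_{j=1}^n f(j)=\sum_{l=0}^{p-1}N(n,l)\left(\sum_{m\le l}\chi(m)\right).$$
   Context: The inner sum $\sum_{m\le l}\chi(m)$ is over positive integers $m\le l$ (empty for $l=0$). By complete multiplicativity, $f(p^lm)=\chi(m)$ for $l\ge0$ and $p\nmid m$. *)

theory Defs
  imports Complex_Main "HOL-Computational_Algebra.Primes" "HOL-Library.Log_Nat"
begin

text \<open>
  Characters live on the natural numbers: a Dirichlet character on the integers is periodic,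
  hence determined by its restriction to the natural numbers.
\<close>

definition dirichlet_character :: "nat \<Rightarrow> (nat \<Rightarrow> complex) \<Rightarrow> bool" where
  "dirichlet_character k \<chi> \<longleftrightarrow>
     \<chi> 1 = 1 \<and>
     (\<forall>a b. \<chi> (a * b) = \<chi> a * \<chi> b) \<and>
     (\<forall>a. \<chi> (a + k) = \<chi> a) \<and>
     (\<forall>a. \<chi> a = 0 \<longleftrightarrow> \<not> coprime a k)"

definition principal_character :: "nat \<Rightarrow> nat \<Rightarrow> complex" where
  "principal_character k a = (if coprime a k then 1 else 0)"

text \<open>Arithmetic functions are only considered at positive arguments; the value at \<open>0\<close> is junk.\<close>

definition completely_multiplicative :: "(nat \<Rightarrow> complex) \<Rightarrow> bool" where
  "completely_multiplicative f \<longleftrightarrow>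
     f 1 = 1 \<and> (\<forall>a>0. \<forall>b>0. f (a * b) = f a * f b)"

text \<open>
  For \<open>b > 1\<close> and \<open>n > 0\<close>, \<^term>\<open>floorlog b n\<close> is the length of the base \<open>b\<close> expansion of \<open>n\<close>,
  so leading zeros are not counted.
\<close>

definition digit_count :: "nat \<Rightarrow> nat \<Rightarrow> nat \<Rightarrow> nat" where
  "digit_count b n l = card {i. i < floorlog b n \<and> n div b ^ i mod b = l}"

end

theory Submission
  imports Defs "HOL-Number_Theory.Cong"
begin

text \<open>
  Split \<open>\<Sum>j\<le>n. f j\<close> according to whether \<open>p\<close> divides \<open>j\<close>. The multiples of \<open>p\<close> contribute the same
  sum up to \<open>n div p\<close>, because \<open>f (p * m) = f m\<close>. On the other \<open>j\<close> the function \<open>f\<close> is \<open>\<chi>\<close>, whose sum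
  over a full period vanishes, so only the incomplete period up to the last digit \<open>n mod p\<close> counts.
  Passing from \<open>n\<close> to \<open>n div p\<close> removes the last digit, and iterating consumes all digits.
\<close>

lemma dirichlet_character_mod:
  assumes "dirichlet_character k \<chi>"
  shows "\<chi> (a mod k) = \<chi> a"
proof -
  have per: "\<chi> (b + k) = \<chi> b" for b
    using assms by (simp add: dirichlet_character_def)
  have "\<chi> (b + c * k) = \<chi> b" for b c
  proof (induction c)
    case (Suc c)
    then show ?case using per[of "b + c * k"] by (simp add: algebra_simps)
  qed simp
  from this[of "a mod k" "a div k"] show ?thesis by simp
qed

text \<open>Multiplication by a unit \<open>a\<close> permutes the residues, so the sum equals
  \<open>\<chi> a\<close> times itself. Non-principality supplies a unit with
  \<open>\<chi> a \<noteq> 1\<close>, which forces the sum to be 0.\<close>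

lemma dirichlet_character_sum_period:
  assumes \<chi>: "dirichlet_character k \<chi>" "\<chi> \<noteq> principal_character k"
  shows "(\<Sum>m<k. \<chi> m) = 0"
proof -
  have mult: "\<chi> (a * b) = \<chi> a * \<chi> b" and zero: "\<chi> a = 0 \<longleftrightarrow> \<not> coprime a k" for a b
    using \<chi>(1) by (simp_all add: dirichlet_character_def)
  obtain a where a: "\<chi> a \<noteq> principal_character k a"
    using \<chi>(2) by blast
  \<comment> \<open>Both characters vanish off the units, so they can differ only at a unit, where
    the principal one is 1.\<close>
  then have cop: "coprime a k" and ne1: "\<chi> a \<noteq> 1"
    using zero[of a] by (auto simp: principal_character_def split: if_splits)
  have inj: "inj_on (\<lambda>m. a * m mod k) {..<k}"
  proof (rule inj_onI)
    fix x y assume xy: "x \<in> {..<k}" "y \<in> {..<k}" "a * x mod k = a * y mod k"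
    then have "[x = y] (mod k)"
      using cong_mult_lcancel_nat[OF cop] by (simp add: cong_def)
    then show "x = y" using xy by (simp add: cong_def)
  qed
  have "(\<lambda>m. a * m mod k) ` {..<k} = {..<k}"
    by (rule endo_inj_surj) (use inj in auto)
  then have "(\<Sum>m<k. \<chi> m) = (\<Sum>m<k. \<chi> (a * m mod k))"
    using sum.reindex[OF inj, of \<chi>] by simp
  also have "\<dots> = \<chi> a * (\<Sum>m<k. \<chi> m)"
    by (simp add: dirichlet_character_mod[OF \<chi>(1)] mult sum_distrib_left)
  finally show ?thesis using ne1 by simp
qed

text \<open>Strong induction peeling off one prime factor \<open>q\<close>: as \<open>p\<close> does
  not divide \<open>j\<close>, neither is \<open>q\<close> equal to \<open>p\<close> nor does
  \<open>p\<close> divide the cofactor.\<close>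

lemma completely_multiplicative_eq_character:
  assumes "prime p" "dirichlet_character p \<chi>" "completely_multiplicative f"
    and eq: "\<And>q. prime q \<Longrightarrow> q \<noteq> p \<Longrightarrow> f q = \<chi> q"
    and "\<not> p dvd j"
  shows "f j = \<chi> j"
  using \<open>\<not> p dvd j\<close>
proof (induction j rule: less_induct)
  case (less j)
  have "j \<noteq> 0" using less.prems by (metis dvd_0_right)
  show ?case
  proof (cases "j = 1")
    case True
    then show ?thesis using assms by (simp add: dirichlet_character_def completely_multiplicative_def)
  next
    case False
    then obtain q where q: "prime q" "q dvd j" using prime_factor_nat by blast
    then obtain m where j: "j = q * m" by auto
    have "q \<noteq> p" "\<not> p dvd m" using less.prems j by auto
    moreover have "m < j" "m > 0" "q > 0"
      using \<open>j \<noteq> 0\<close> j prime_gt_1_nat[OF q(1)] by auto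
    ultimately show ?thesis
      using less.IH[of m] eq[OF q(1)] assms(2,3) j
      by (simp add: dirichlet_character_def completely_multiplicative_def)
  qed
qed

lemma sum_completely_multiplicative_div_mod:
  assumes "prime p" and \<chi>: "dirichlet_character p \<chi>" "\<chi> \<noteq> principal_character p"
    and f: "completely_multiplicative f" "f p = 1"
    and eq: "\<And>q. prime q \<Longrightarrow> q \<noteq> p \<Longrightarrow> f q = \<chi> q"
  shows "(\<Sum>j=1..n. f j) = (\<Sum>j=1..n div p. f j) + (\<Sum>m=1..n mod p. \<chi> m)"
proof (induction n)
  case (Suc n)
  have p: "p > 1" using \<open>prime p\<close> by (rule prime_gt_1_nat)
  show ?case
  proof (cases "p dvd Suc n")
    case True
    then have last: "n mod p = p - 1" and m: "Suc n mod p = 0" "Suc n div p = Suc (n div p)"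
      using p by (auto simp: mod_Suc div_Suc dvd_eq_mod_eq_0 split: if_splits)
    have "Suc n = p * Suc (n div p)"
      using True m(2) by (metis dvd_mult_div_cancel)
    then have "f (Suc n) = f (Suc (n div p))"
      using f p unfolding completely_multiplicative_def by (metis mult_1 zero_less_Suc less_trans zero_less_one)
    \<comment> \<open>The last digit rolls over from \<open>p - 1\<close> to 0, so the character sum
      resets to the empty sum. Nothing is lost, because the discarded sum is a full period: the
      missing term \<open>\<chi> 0\<close> is 0.\<close>
    moreover have "(\<Sum>m=1..p - 1. \<chi> m) = 0"
    proof -
      have "{..<p} = insert 0 {1..p - 1}" using p by auto
      moreover have "\<chi> 0 = 0" using \<chi>(1) p by (simp add: dirichlet_character_def)
      ultimately show ?thesis using dirichlet_character_sum_period[OF \<chi>] by simp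
    qed
    ultimately show ?thesis using Suc.IH last m by simp
  next
    case False
    then have m: "Suc n mod p = Suc (n mod p)" "Suc n div p = n div p"
      by (auto simp: mod_Suc div_Suc dvd_eq_mod_eq_0 split: if_splits)
    \<comment> \<open>Without a carry the quotient stays fixed, and the new term is exactly the one
      that extends the incomplete period.\<close>
    have "f (Suc n) = \<chi> (Suc n mod p)"
      using completely_multiplicative_eq_character[OF \<open>prime p\<close> \<chi>(1) f(1) eq False]
      by (simp add: dirichlet_character_mod[OF \<chi>(1)])
    then show ?thesis using Suc.IH m by simp
  qed
qed simp

text \<open>Digit positions are grouped by their digit: the fibre over \<open>l\<close> has
  \<open>digit_count b n l\<close> elements, and the summand is constantly \<open>g l\<close> on
  it.\<close>

lemma sum_digit_count:
  fixes g :: "nat \<Rightarrow> 'a::semiring_1"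
  assumes "b > 0"
  shows "(\<Sum>l=0..b-1. of_nat (digit_count b n l) * g l) = (\<Sum>i<floorlog b n. g (n div b ^ i mod b))"
proof -
  have "(\<lambda>i. n div b ^ i mod b) ` {..<floorlog b n} \<subseteq> {0..b-1}"
    using assms by (auto intro!: less_imp_le_nat simp: less_Suc_eq_le[symmetric])
  then have "(\<Sum>i<floorlog b n. g (n div b ^ i mod b)) =
      (\<Sum>l=0..b-1. \<Sum>i | i \<in> {..<floorlog b n} \<and> n div b ^ i mod b = l. g (n div b ^ i mod b))"
    by (intro sum.group[symmetric]) auto
  also have "\<dots> = (\<Sum>l=0..b-1. of_nat (digit_count b n l) * g l)"
    by (intro sum.cong) (simp_all add: digit_count_def)
  finally show ?thesis by simp
qed

lemma sum_digits_rec: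
  fixes g :: "nat \<Rightarrow> 'a::comm_monoid_add"
  assumes "b > 1" "n > 0"
  shows "(\<Sum>i<floorlog b n. g (n div b ^ i mod b)) =
    g (n mod b) + (\<Sum>i<floorlog b (n div b). g (n div b div b ^ i mod b))"
proof -
  \<comment> \<open>This includes one-digit \<open>n\<close>, where \<open>n div b = 0\<close> has
    length 0.\<close>
  have "floorlog b n = Suc (floorlog b (n div b))"
    using assms compute_floorlog[of b n] by simp
  then show ?thesis
    by (simp add: sum.lessThan_Suc_shift div_mult2_eq del: sum.lessThan_Suc)
qed

theorem theorem9:
  fixes p n :: nat and \<chi> f :: "nat \<Rightarrow> complex"
  assumes "prime p"
    and "dirichlet_character p \<chi>" and "\<chi> \<noteq> principal_character p"
    and "completely_multiplicative f"
    and "f p = 1" and "\<And>q. prime q \<Longrightarrow> q \<noteq> p \<Longrightarrow> f q = \<chi> q"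
    and "n > 0"
  shows "(\<Sum>j=1..n. f j) =
         (\<Sum>l=0..p-1. of_nat (digit_count p n l) * (\<Sum>m=1..l. \<chi> m))"
proof -
  have p: "p > 1" using \<open>prime p\<close> by (rule prime_gt_1_nat)
  have "(\<Sum>j=1..n. f j) = (\<Sum>i<floorlog p n. \<Sum>m=1..n div p ^ i mod p. \<chi> m)"
  proof (induction n rule: less_induct)
    case (less n)
    show ?case
    proof (cases "n = 0")
      case True
      \<comment> \<open>Repeated division by \<open>p\<close> ends at 0, whose expansion has length
        0, so both sums are empty.\<close>
      then show ?thesis by (simp add: floorlog_def)
    next
      case False
      then have "n div p < n" using p by simp
      from less.IH[OF this] show ?thesis
        using sum_completely_multiplicative_div_mod[OF assms(1-6), of n]
          sum_digits_rec[of p n "\<lambda>l. \<Sum>m=1..l. \<chi> m"] p False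
        by (simp add: add.commute)
    qed
  qed
  then show ?thesis using sum_digit_count[of p n "\<lambda>l. \<Sum>m=1..l. \<chi> m"] p by simp
qed

end
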